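(* For any two-party $n$-round bias-$X_0$ coin-tossing protocol, there exists a fail-stop adversary that changes the probability that the honest party outputs heads by at least $\frac1{12}C'_n(X_0)$, and moreover $\frac1{12}C'_n(X_0)\geq \frac1{12}\sqrt{\frac{2}{n+1}}\,X_0(1-X_0)$.
   Context: A two-party $n$-round coin-tossing protocol is an interactive protocol between Alice and Bob who send messages in alternate rounds (Alice in rounds $1,3,\dots$, Bob in rounds $2,4,\dots$); in an honest execution both output a coin (heads/tails) determined by the full transcript, and it is bias-$X_0$ if heads occurs with probability $X_0$. The protocol must guarantee output: if a party aborts instead of sending its round-$(i+1)$ message, the other party outputs heads with some probability $D_i$ that is a function of the partial transcript after round $i$. A fail-stop adversary controls one party, follows the protocol honestly, but may abort prematurely. The transform $T$ on curves $Y=f(X)$ ($f:[0,1]\to\mathbb{R}_{\ge0}$): $T$ of it is $Y=g(X)$, where $x_S(x)\in[0,1]$ solves $X+f(X)=x$, $x_L(x)\in[0,1]$ solves $X-f(X)=x$, and $g(x)=2ab/(a+b)$ with $a=f(x_S(x))$, $b=f(x_L(x))$ (taken to be $0$ if $a$ or $b$ is $0$). Define $C'_1(X)=X(1-X)$ and $C'_n=T^{n-1}(C'_1)$. *)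

theory Defs
  imports "HOL-Probability.Probability"
begin

section \<open>Coin-tossing protocols\<close>

text \<open>
  A transcript is the list of messages sent so far, oldest first; \<^const>\<open>True\<close> stands for heads.
  Each party has a private local state. When it is its turn, it samples its next message together
  with its new state from a distribution that depends on its state and on the transcript, so that
  arbitrary private randomness is covered; the randomness of the two parties is independent. The
  common output of an honest execution is a function of the full transcript. If the party
  to move aborts at transcript \<open>h\<close>, then the other party outputs a coin sampled from
  \<open>defense h\<close>; its probability of heads is the $D_i$ with $i$ the length of \<open>h\<close>.
\<close>

record ('a, 'b, 'm) protocol =
  init_alice :: 'a
  init_bob :: 'b
  step_alice :: "'a \<Rightarrow> 'm list \<Rightarrow> ('m \<times> 'a) pmf"
  step_bob :: "'b \<Rightarrow> 'm list \<Rightarrow> ('m \<times> 'b) pmf"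
  outcome :: "'m list \<Rightarrow> bool"
  defense :: "'m list \<Rightarrow> bool pmf"

text \<open>
  \<open>run P qA qB k a b h\<close> is the law of the output when \<open>k\<close> rounds remain, the transcript is \<open>h\<close>,
  and the local states are \<open>a\<close> and \<open>b\<close>. Alice moves in rounds $1, 3, \ldots$, that is, when the
  length of the transcript so far is even. The abort rules \<open>qA\<close> and \<open>qB\<close> are
  evaluated after the mover has sampled its next message but before the message is sent: their
  arguments are the mover's new state and the transcript extended by the pending message. If the
  mover aborts, the defense only sees the transcript without that message.
\<close>

primrec run ::
  "('a, 'b, 'm) protocol \<Rightarrow> ('a \<Rightarrow> 'm list \<Rightarrow> bool) \<Rightarrow> ('b \<Rightarrow> 'm list \<Rightarrow> bool) \<Rightarrow>
   nat \<Rightarrow> 'a \<Rightarrow> 'b \<Rightarrow> 'm list \<Rightarrow> bool pmf" where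
  "run P qA qB 0 a b h = return_pmf (outcome P h)"
| "run P qA qB (Suc k) a b h =
    (if even (length h)
     then bind_pmf (step_alice P a h) (\<lambda>(m, a').
            if qA a' (h @ [m]) then defense P h else run P qA qB k a' b (h @ [m]))
     else bind_pmf (step_bob P b h) (\<lambda>(m, b').
            if qB b' (h @ [m]) then defense P h else run P qA qB k a b' (h @ [m])))"

definition honest_run :: "('a, 'b, 'm) protocol \<Rightarrow> nat \<Rightarrow> bool pmf" where
  "honest_run P n = run P (\<lambda>_ _. False) (\<lambda>_ _. False) n (init_alice P) (init_bob P) []"

definition bias :: "('a, 'b, 'm) protocol \<Rightarrow> nat \<Rightarrow> real" where
  "bias P n = pmf (honest_run P n) True"

text \<open>
  A fail-stop adversary is given by the corrupted party and its abort rule. Deterministic rules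
  suffice, as the random coins of a randomized rule can be fixed to their best value.
\<close>

datatype ('a, 'b, 'm) fail_stop =
    Corrupt_Alice "'a \<Rightarrow> 'm list \<Rightarrow> bool"
  | Corrupt_Bob "'b \<Rightarrow> 'm list \<Rightarrow> bool"

primrec attacked_run :: "('a, 'b, 'm) protocol \<Rightarrow> nat \<Rightarrow> ('a, 'b, 'm) fail_stop \<Rightarrow> bool pmf" where
  "attacked_run P n (Corrupt_Alice q) = run P q (\<lambda>_ _. False) n (init_alice P) (init_bob P) []"
| "attacked_run P n (Corrupt_Bob q) = run P (\<lambda>_ _. False) q n (init_alice P) (init_bob P) []"


section \<open>The curve transform\<close>

text \<open>
  Only the values of a curve on the unit interval matter. For all iterates of the transform starting
  from $X(1-X)$, both equations below have exactly one solution in the unit interval for every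
  \<open>x\<close> there.
\<close>

definition x_S :: "(real \<Rightarrow> real) \<Rightarrow> real \<Rightarrow> real" where
  "x_S f x = (THE X. X \<in> {0..1} \<and> X + f X = x)"

definition x_L :: "(real \<Rightarrow> real) \<Rightarrow> real \<Rightarrow> real" where
  "x_L f x = (THE X. X \<in> {0..1} \<and> X - f X = x)"

definition transform_T :: "(real \<Rightarrow> real) \<Rightarrow> real \<Rightarrow> real" where
  "transform_T f x =
    (let a = f (x_S f x); b = f (x_L f x)
     in if a = 0 \<or> b = 0 then 0 else 2 * a * b / (a + b))"

definition C' :: "nat \<Rightarrow> real \<Rightarrow> real" where
  "C' n = (transform_T ^^ (n - 1)) (\<lambda>X. X * (1 - X))"

end

theory Submission imports Defs begin

text \<open>
  Restrict to abort rules that look at the transcript only, and let the score of a transcript be the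
  sum of the best gains of the four attackers (Alice or Bob, towards heads or tails). If a node has
  value $x$ and defense $d$, and its children have values $x_m$ and scores $S_m$, then its score is at
  least $|d - x|$ (the mover always aborts) and at least the mean of $\max(|d - x_m|, S_m)$ (the mover
  aborts in one direction, or everybody continues). By induction $S_m \ge f(x_m)/3$ with
  $f = C'_k$, and we want the score to be at least $(T f)(x)/3$. This is clear if
  $|d - x| \ge (T f)(x)/3$. Otherwise $\max(|d - x_m|, f(x_m)/3)$ lies above one third of the chord of
  $f$ through the abscissae $x_S(x)$ and $x_L(x)$, whose value at $x$ is $(T f)(x)$: between these
  points by concavity of $f$, and outside because there $|x_m - x| \ge (T f)(x)/2$, so that
  $|d - x_m| \ge |x_m - x|/3$. One of the four gains is then at least $C'_n(X_0)/12$.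

  The transform preserves concavity: $a = f(x_S(x))$ is the largest solution of
  $a \le f(x - a)$, hence concave in $x$, similarly for $b$, and the harmonic mean is concave and
  monotone.
\<close>

section \<open>Concave curves and the transform\<close>

definition harmonic_mean :: "real \<Rightarrow> real \<Rightarrow> real" where
  "harmonic_mean a b = 2 * a * b / (a + b)"

text \<open>Times \<open>a + b\<close>, the two sides differ by twice the square of
  \<open>t * a - (1 - t) * b\<close>. For fixed \<open>t\<close> the bound is linear in the pair,
  and \<open>t = b / (a + b)\<close> attains it; this gives concavity and monotonicity
  together.\<close>

lemma harmonic_mean_le_weighted:
  assumes "a \<ge> 0" "b \<ge> 0"
  shows "harmonic_mean a b \<le> 2 * (t\<^sup>2 * a + (1 - t)\<^sup>2 * b)"
proof (cases "a + b = 0")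
  case True
  then show ?thesis using assms by (simp add: harmonic_mean_def)
next
  case False
  then have pos: "a + b > 0" using assms by linarith
  have "(t\<^sup>2 * a + (1 - t)\<^sup>2 * b) * (a + b) - a * b = (t * a - (1 - t) * b)\<^sup>2"
    by (simp add: power2_eq_square algebra_simps)
  then have "2 * a * b \<le> 2 * (t\<^sup>2 * a + (1 - t)\<^sup>2 * b) * (a + b)"
    using zero_le_power2[of "t * a - (1 - t) * b"] by linarith
  then show ?thesis using pos by (simp add: harmonic_mean_def divide_le_eq)
qed

lemma harmonic_mean_eq_weighted:
  assumes "a + b \<noteq> 0"
  shows "harmonic_mean a b = 2 * ((b / (a + b))\<^sup>2 * a + (1 - b / (a + b))\<^sup>2 * b)"
proof -
  have *: "1 - b / (a + b) = a / (a + b)" using assms by (simp add: field_simps)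
  have "(b / (a + b))\<^sup>2 * a + (a / (a + b))\<^sup>2 * b = (a * b * (a + b)) / (a + b)\<^sup>2"
    by (simp add: power2_eq_square add_divide_distrib algebra_simps)
  also have "\<dots> = a * b / (a + b)" using assms by (simp add: power2_eq_square)
  finally show ?thesis unfolding * harmonic_mean_def by simp
qed

lemma harmonic_mean_nonneg: "a \<ge> 0 \<Longrightarrow> b \<ge> 0 \<Longrightarrow> harmonic_mean a b \<ge> 0"
  by (simp add: harmonic_mean_def)

lemma harmonic_mean_pos: "a > 0 \<Longrightarrow> b > 0 \<Longrightarrow> harmonic_mean a b > 0"
  by (simp add: harmonic_mean_def)

lemma harmonic_mean_commute: "harmonic_mean a b = harmonic_mean b a"
  by (simp add: harmonic_mean_def algebra_simps)

lemma harmonic_mean_le_double: "a \<ge> 0 \<Longrightarrow> b \<ge> 0 \<Longrightarrow> harmonic_mean a b \<le> 2 * a"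
  using harmonic_mean_le_weighted[of a b 1] by simp

lemma harmonic_mean_concave_mono:
  assumes "a \<ge> 0" "b \<ge> 0" "a' \<ge> 0" "b' \<ge> 0" "u \<ge> 0" "v \<ge> 0"
    and A: "u * a + v * a' \<le> A" and B: "u * b + v * b' \<le> B"
  shows "u * harmonic_mean a b + v * harmonic_mean a' b' \<le> harmonic_mean A B"
proof -
  have nn: "0 \<le> u * a + v * a'" "0 \<le> u * b + v * b'" using assms by simp_all
  show ?thesis
  proof (cases "A + B = 0")
    case True
    then have "A = 0" "B = 0" using nn A B by linarith+
    then have "u * a + v * a' = 0" using nn A by linarith
    then have "u * a = 0" "v * a' = 0" using assms
      by (smt (verit) mult_nonneg_nonneg)+
    then show ?thesis using True \<open>A = 0\<close> by (auto simp: harmonic_mean_def)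
  next
    case False
    define t where "t = B / (A + B)"
    have "u * harmonic_mean a b + v * harmonic_mean a' b'
        \<le> u * (2 * (t\<^sup>2 * a + (1 - t)\<^sup>2 * b)) + v * (2 * (t\<^sup>2 * a' + (1 - t)\<^sup>2 * b'))"
      using assms by (intro add_mono mult_left_mono harmonic_mean_le_weighted) auto
    also have "\<dots> = 2 * (t\<^sup>2 * (u * a + v * a') + (1 - t)\<^sup>2 * (u * b + v * b'))"
      by (simp add: algebra_simps)
    also have "\<dots> \<le> 2 * (t\<^sup>2 * A + (1 - t)\<^sup>2 * B)"
      using A B by (intro add_mono mult_left_mono) auto
    also have "\<dots> = harmonic_mean A B"
      using harmonic_mean_eq_weighted[OF False] by (simp add: t_def)
    finally show ?thesis .
  qed
qed

section \<open>Curves on which the transform is well behaved\<close>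

lemma transform_T_eq_harmonic_mean: "transform_T f x = harmonic_mean (f (x_S f x)) (f (x_L f x))"
  by (simp add: transform_T_def harmonic_mean_def Let_def)

lemma convex_comb_unit:
  fixes x y u v :: real
  assumes "x \<in> {0..1}" "y \<in> {0..1}" "0 \<le> u" "0 \<le> v" "u + v = 1"
  shows "u * x + v * y \<in> {0..1}"
  using convexD[of "{0..1::real}" x y u v] assms by auto

text \<open>Together with concavity, the last two bounds make \<open>X + f X\<close> and
  \<open>X - f X\<close> strictly increasing, so that \<open>x_S\<close> and \<open>x_L\<close> are
  well defined. The class is closed under \<open>transform_T\<close>.\<close>

locale hump =
  fixes f :: "real \<Rightarrow> real"
  assumes concave: "concave_on {0..1} f"
    and f_0 [simp]: "f 0 = 0" and f_1 [simp]: "f 1 = 0"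
    and f_pos: "0 < X \<Longrightarrow> X < 1 \<Longrightarrow> 0 < f X"
    and f_less: "0 < X \<Longrightarrow> X < 1 \<Longrightarrow> f X < X"
    and f_less': "0 < X \<Longrightarrow> X < 1 \<Longrightarrow> f X < 1 - X"
begin

lemma concaveD:
  assumes "X \<in> {0..1}" "Y \<in> {0..1}" "0 \<le> u" "0 \<le> v" "u + v = 1"
  shows "u * f X + v * f Y \<le> f (u * X + v * Y)"
  using concave assms unfolding concave_on_iff by (auto simp: scaleR_conv_of_real)

lemma f_nonneg: "X \<in> {0..1} \<Longrightarrow> 0 \<le> f X"
  using f_pos[of X] by (cases "X = 0 \<or> X = 1") auto

text \<open>\<open>Y\<close> lies between \<open>X\<close> and \<open>1\<close>, so concavity limits
  the drop of \<open>f\<close> to \<open>(1 - u) * f X\<close>, which is less than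
  \<open>Y - X\<close> because \<open>f X < 1 - X\<close>.\<close>

lemma plus_strict_mono:
  assumes "0 \<le> X" "X < Y" "Y \<le> 1"
  shows "X + f X < Y + f Y"
proof -
  define u where "u = (1 - Y) / (1 - X)"
  have u1: "(1 - u) * (1 - X) = Y - X" using assms by (simp add: u_def field_simps)
  then have u_comb: "u * X + (1 - u) * 1 = Y" by (simp add: algebra_simps)
  have u: "0 \<le> u" "u < 1" using assms by (auto simp: u_def)
  have "u * f X + (1 - u) * f 1 \<le> f Y"
    using concaveD[of X 1 u "1 - u"] assms u u_comb by auto
  then have "f X - f Y \<le> (1 - u) * f X" by (simp add: algebra_simps)
  moreover have "f X < 1 - X"
    using f_less'[of X] assms by (cases "X = 0") auto
  then have "(1 - u) * f X < (1 - u) * (1 - X)" using u by simp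
  ultimately show ?thesis using u1 by linarith
qed

lemma minus_strict_mono:
  assumes "0 \<le> X" "X < Y" "Y \<le> 1"
  shows "X - f X < Y - f Y"
proof -
  define u where "u = X / Y"
  have u: "0 \<le> u" "u < 1" "(1 - u) * 0 + u * Y = X"
    using assms by (auto simp: u_def field_simps)
  have "(1 - u) * f 0 + u * f Y \<le> f X"
    using concaveD[of 0 Y "1 - u" u] assms u by auto
  then have "f Y - f X \<le> (1 - u) * f Y" by (simp add: algebra_simps)
  moreover have "f Y < Y"
    using f_less[of Y] assms by (cases "Y = 1") auto
  then have "(1 - u) * f Y < (1 - u) * Y" using u by simp
  moreover have "(1 - u) * Y = Y - X" using assms by (simp add: u_def field_simps)
  ultimately show ?thesis by linarith
qed

lemma lipschitz:
  assumes "X \<in> {0..1}" "Y \<in> {0..1}"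
  shows "\<bar>f X - f Y\<bar> \<le> \<bar>X - Y\<bar>"
  using plus_strict_mono[of X Y] plus_strict_mono[of Y X]
    minus_strict_mono[of X Y] minus_strict_mono[of Y X] assms
  by (cases X Y rule: linorder_cases) auto

lemma continuous: "continuous_on {0..1} f"
proof -
  have "1-lipschitz_on {0..1} f"
    using lipschitz by (auto simp: lipschitz_on_def dist_real_def)
  then show ?thesis by (rule lipschitz_on_continuous_on)
qed

lemma x_S:
  assumes "x \<in> {0..1}"
  shows "x_S f x \<in> {0..1}" "x_S f x + f (x_S f x) = x"
proof -
  have "\<exists>X\<ge>0. X \<le> 1 \<and> X + f X = x"
    using assms by (intro IVT') (auto intro!: continuous_intros continuous)
  then obtain X where "X \<in> {0..1} \<and> X + f X = x" by auto
  moreover have "Y = X" if "Y \<in> {0..1} \<and> Y + f Y = x" for Y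
    using plus_strict_mono[of X Y] plus_strict_mono[of Y X] that calculation
    by (cases X Y rule: linorder_cases) auto
  ultimately have "x_S f x \<in> {0..1} \<and> x_S f x + f (x_S f x) = x"
    unfolding x_S_def by (rule theI)
  then show "x_S f x \<in> {0..1}" "x_S f x + f (x_S f x) = x" by auto
qed

lemma x_L:
  assumes "x \<in> {0..1}"
  shows "x_L f x \<in> {0..1}" "x_L f x - f (x_L f x) = x"
proof -
  have "\<exists>X\<ge>0. X \<le> 1 \<and> X - f X = x"
    using assms by (intro IVT') (auto intro!: continuous_intros continuous)
  then obtain X where "X \<in> {0..1} \<and> X - f X = x" by auto
  moreover have "Y = X" if "Y \<in> {0..1} \<and> Y - f Y = x" for Y
    using minus_strict_mono[of X Y] minus_strict_mono[of Y X] that calculation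
    by (cases X Y rule: linorder_cases) auto
  ultimately have "x_L f x \<in> {0..1} \<and> x_L f x - f (x_L f x) = x"
    unfolding x_L_def by (rule theI)
  then show "x_L f x \<in> {0..1}" "x_L f x - f (x_L f x) = x" by auto
qed

section \<open>One-sided gaps and the chord between the two solutions\<close>

definition gap_S :: "real \<Rightarrow> real" where "gap_S x = f (x_S f x)"
definition gap_L :: "real \<Rightarrow> real" where "gap_L x = f (x_L f x)"

text \<open>The equation \<open>X + f X = x\<close> makes \<open>gap_S x\<close> both the height of
  \<open>f\<close> at \<open>x_S f x\<close> and the distance from there to
  \<open>x\<close>.\<close>

lemma gap_S:
  assumes "x \<in> {0..1}"
  shows "x_S f x = x - gap_S x" "x - gap_S x \<in> {0..1}" "f (x - gap_S x) = gap_S x" "0 \<le> gap_S x"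
  using x_S[OF assms] f_nonneg[of "x_S f x"] by (auto simp: gap_S_def simp flip: eq_diff_eq)

lemma gap_L:
  assumes "x \<in> {0..1}"
  shows "x_L f x = x + gap_L x" "x + gap_L x \<in> {0..1}" "f (x + gap_L x) = gap_L x" "0 \<le> gap_L x"
  using x_L[OF assms] f_nonneg[of "x_L f x"] by (auto simp: gap_L_def diff_eq_eq)

lemma gap_S_pos:
  assumes "0 < x" "x < 1"
  shows "0 < gap_S x"
  using gap_S[of x] assms f_pos[of "x - gap_S x"] by (cases "gap_S x = 0") auto

lemma gap_L_pos:
  assumes "0 < x" "x < 1"
  shows "0 < gap_L x"
  using gap_L[of x] assms f_pos[of "x + gap_L x"] by (cases "gap_L x = 0") auto

text \<open>If \<open>c\<close> were larger, \<open>x - c\<close> would lie to the left of the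
  solution of \<open>X + f X = x\<close>, where the sum is still below \<open>x\<close>.\<close>

lemma gap_S_maximal:
  assumes "x \<in> {0..1}" "x - c \<in> {0..1}" "c \<le> f (x - c)"
  shows "c \<le> gap_S x"
proof (rule ccontr)
  assume "\<not> ?thesis"
  then show False
    using plus_strict_mono[of "x - c" "x - gap_S x"] gap_S[OF assms(1)] assms by auto
qed

lemma gap_L_maximal:
  assumes "x \<in> {0..1}" "x + c \<in> {0..1}" "c \<le> f (x + c)"
  shows "c \<le> gap_L x"
proof (rule ccontr)
  assume "\<not> ?thesis"
  then show False
    using minus_strict_mono[of "x + gap_L x" "x + c"] gap_L[OF assms(1)] assms by auto
qed

lemma T_eq: "transform_T f x = harmonic_mean (gap_S x) (gap_L x)"
  by (simp add: transform_T_eq_harmonic_mean gap_S_def gap_L_def)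

text \<open>The average of the two gaps is a candidate in \<open>gap_S_maximal\<close>, since the
  abscissae \<open>x - gap_S x\<close> average along with it.\<close>

lemma gap_S_concave:
  assumes "x \<in> {0..1}" "y \<in> {0..1}" "0 \<le> u" "0 \<le> v" "u + v = 1"
  shows "u * gap_S x + v * gap_S y \<le> gap_S (u * x + v * y)"
proof (rule gap_S_maximal)
  have eq: "u * x + v * y - (u * gap_S x + v * gap_S y) = u * (x - gap_S x) + v * (y - gap_S y)"
    by (simp add: algebra_simps)
  show "u * x + v * y \<in> {0..1}" using assms by (rule convex_comb_unit)
  show "u * x + v * y - (u * gap_S x + v * gap_S y) \<in> {0..1}"
    unfolding eq using assms gap_S by (intro convex_comb_unit) auto
  show "u * gap_S x + v * gap_S y \<le> f (u * x + v * y - (u * gap_S x + v * gap_S y))"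
    unfolding eq using concaveD[of "x - gap_S x" "y - gap_S y" u v] assms gap_S[of x] gap_S[of y]
    by auto
qed

lemma gap_L_concave:
  assumes "x \<in> {0..1}" "y \<in> {0..1}" "0 \<le> u" "0 \<le> v" "u + v = 1"
  shows "u * gap_L x + v * gap_L y \<le> gap_L (u * x + v * y)"
proof (rule gap_L_maximal)
  have eq: "u * x + v * y + (u * gap_L x + v * gap_L y) = u * (x + gap_L x) + v * (y + gap_L y)"
    by (simp add: algebra_simps)
  show "u * x + v * y \<in> {0..1}" using assms by (rule convex_comb_unit)
  show "u * x + v * y + (u * gap_L x + v * gap_L y) \<in> {0..1}"
    unfolding eq using assms gap_L by (intro convex_comb_unit) auto
  show "u * gap_L x + v * gap_L y \<le> f (u * x + v * y + (u * gap_L x + v * gap_L y))"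
    unfolding eq using concaveD[of "x + gap_L x" "y + gap_L y" u v] assms gap_L[of x] gap_L[of y]
    by auto
qed

text \<open>For \<open>0 < x < 1\<close>, the line through the points of the graph at
  \<open>x_S f x\<close> and \<open>x_L f x\<close>, anchored at \<open>x\<close>, where its height
  is the harmonic mean of the gaps.\<close>

definition chord :: "real \<Rightarrow> real \<Rightarrow> real" where
  "chord x X = transform_T f x + (X - x) * ((gap_L x - gap_S x) / (gap_S x + gap_L x))"

lemma chord_le_f:
  assumes x: "0 < x" "x < 1" and X: "x - gap_S x \<le> X" "X \<le> x + gap_L x"
  shows "chord x X \<le> f X"
proof -
  let ?a = "gap_S x" and ?b = "gap_L x"
  have pos: "0 < ?a" "0 < ?b" using x by (rule gap_S_pos, rule gap_L_pos)
  define u where "u = (x + ?b - X) / (?a + ?b)"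
  have u: "0 \<le> u" "u \<le> 1" using pos X by (auto simp: u_def field_simps)
  have eq: "u * (?a + ?b) = x + ?b - X" using pos by (simp add: u_def)
  then have X_eq: "u * (x - ?a) + (1 - u) * (x + ?b) = X" by (simp add: algebra_simps)
  have "chord x X = u * ?a + (1 - u) * ?b"
    using pos by (simp add: chord_def T_eq harmonic_mean_def u_def divide_simps) (simp add: algebra_simps)
  also have "\<dots> \<le> f (u * (x - ?a) + (1 - u) * (x + ?b))"
    using concaveD[of "x - ?a" "x + ?b" u "1 - u"] u gap_S[of x] gap_L[of x] x by auto
  finally show ?thesis by (simp only: X_eq)
qed

text \<open>The chord meets the line \<open>x - X\<close> at the left endpoint and has slope greater
  than \<open>-1\<close>, so further left it stays below that line.\<close>

lemma chord_le_dist_S: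
  assumes x: "0 < x" "x < 1" and X: "X \<le> x - gap_S x"
  shows "chord x X \<le> x - X"
proof -
  let ?a = "gap_S x" and ?b = "gap_L x"
  have pos: "0 < ?a" "0 < ?b" using x by (rule gap_S_pos, rule gap_L_pos)
  have "x - X - chord x X = 2 * ?b * (x - ?a - X) / (?a + ?b)"
    using pos by (simp add: chord_def T_eq harmonic_mean_def divide_simps) (simp add: algebra_simps)
  also have "\<dots> \<ge> 0" using pos X by simp
  finally show ?thesis by simp
qed

lemma chord_le_dist_L:
  assumes x: "0 < x" "x < 1" and X: "x + gap_L x \<le> X"
  shows "chord x X \<le> X - x"
proof -
  let ?a = "gap_S x" and ?b = "gap_L x"
  have pos: "0 < ?a" "0 < ?b" using x by (rule gap_S_pos, rule gap_L_pos)
  have "X - x - chord x X = 2 * ?a * (X - x - ?b) / (?a + ?b)"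
    using pos by (simp add: chord_def T_eq harmonic_mean_def divide_simps) (simp add: algebra_simps)
  also have "\<dots> \<ge> 0" using pos X by simp
  finally show ?thesis by simp
qed

lemma T_le_f: "0 < x \<Longrightarrow> x < 1 \<Longrightarrow> transform_T f x \<le> f x"
  using chord_le_f[of x x] gap_S(4)[of x] gap_L(4)[of x] by (simp add: chord_def)

lemma T_0: "transform_T f 0 = 0"
proof -
  have "gap_S 0 = 0" using gap_S[of 0] by auto
  then show ?thesis by (simp add: T_eq harmonic_mean_def)
qed

lemma T_1: "transform_T f 1 = 0"
proof -
  have "gap_L 1 = 0" using gap_L[of 1] by auto
  then show ?thesis by (simp add: T_eq harmonic_mean_def)
qed

lemma hump_transform_T: "hump (transform_T f)"
proof
  show "concave_on {0..1} (transform_T f)"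
    unfolding concave_on_iff
    by (auto simp: T_eq intro!: harmonic_mean_concave_mono gap_S_concave gap_L_concave gap_S(4) gap_L(4))
  show "transform_T f 0 = 0" by (rule T_0)
  show "transform_T f 1 = 0" by (rule T_1)
  fix X :: real assume X: "0 < X" "X < 1"
  show "0 < transform_T f X"
    using gap_S_pos[OF X] gap_L_pos[OF X] by (simp add: T_eq harmonic_mean_pos)
  show "transform_T f X < X" using T_le_f[OF X] f_less[OF X] by simp
  show "transform_T f X < 1 - X" using T_le_f[OF X] f_less'[OF X] by simp
qed

section \<open>The inequality for one round\<close>

lemma score_pointwise:
  assumes x: "0 < x" "x < 1" and d: "\<bar>d - x\<bar> \<le> transform_T f x / 3"
  shows "chord x X / 3 \<le> max \<bar>d - X\<bar> (f X / 3)"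
proof -
  \<comment> \<open>Beyond either gap, \<open>\<bar>X - x\<bar>\<close> is at least half of
    \<open>transform_T f x\<close>, so moving from \<open>x\<close> to \<open>d\<close> costs at
    most two thirds of it. The threshold \<open>1/3\<close> is the solution of
    \<open>1 - 2 * c = c\<close>.\<close>
  have "transform_T f x \<le> 2 * gap_S x" "transform_T f x \<le> 2 * gap_L x"
    unfolding T_eq using harmonic_mean_le_double[of "gap_S x" "gap_L x"] harmonic_mean_le_double[of "gap_L x" "gap_S x"]
      gap_S(4)[of x] gap_L(4)[of x] x by (simp_all add: harmonic_mean_commute[of "gap_S x"])
  then show ?thesis
    using chord_le_f[OF x, of X] chord_le_dist_S[OF x, of X] chord_le_dist_L[OF x, of X] d
    by (cases "X \<le> x - gap_S x"; cases "x + gap_L x \<le> X") linarith+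
qed

text \<open>Here \<open>X m\<close> and \<open>S m\<close> stand for the value and score of child
  \<open>m\<close>. The chord is affine, so its mean over the children is its height at
  \<open>x\<close>. The bound \<open>c\<close> serves integrability.\<close>

lemma score_step:
  assumes X: "\<And>m. X m \<in> {0..1}"
    and x: "x = measure_pmf.expectation M X"
    and S: "\<And>m. f (X m) / 3 \<le> S m" "\<And>m. S m \<le> c"
    and s: "\<bar>d - x\<bar> \<le> s" "measure_pmf.expectation M (\<lambda>m. max \<bar>d - X m\<bar> (S m)) \<le> s"
  shows "transform_T f x / 3 \<le> s"
proof (cases "0 < x \<and> x < 1 \<and> \<bar>d - x\<bar> \<le> transform_T f x / 3")
  case True
  have int_X: "integrable M X"
    using X by (intro measure_pmf.integrable_const_bound[where B=1]) auto
  let ?r = "(gap_L x - gap_S x) / (gap_S x + gap_L x)"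
  have "transform_T f x / 3 = chord x x / 3" by (simp add: chord_def)
  also have "\<dots> = measure_pmf.expectation M (\<lambda>m. chord x (X m) / 3)"
    using int_X by (simp add: chord_def x[symmetric])
  also have "\<dots> \<le> measure_pmf.expectation M (\<lambda>m. max \<bar>d - X m\<bar> (S m))"
  proof (rule integral_mono)
    show "integrable M (\<lambda>m. chord x (X m) / 3)" using int_X by (simp add: chord_def)
    have "\<bar>max (\<bar>d - X m\<bar>) (S m)\<bar> \<le> max (\<bar>d\<bar> + 1) c" for m
      using X[of m] S[of m] by auto
    then show "integrable M (\<lambda>m. max \<bar>d - X m\<bar> (S m))"
      by (intro measure_pmf.integrable_const_bound[where B="max (\<bar>d\<bar> + 1) c"]) auto
    show "chord x (X m) / 3 \<le> max \<bar>d - X m\<bar> (S m)" for m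
      using score_pointwise[of x d "X m"] S(1)[of m] True by linarith
  qed
  finally show ?thesis using s by simp
next
  case False
  have "0 \<le> x" unfolding x using X by (intro Bochner_Integration.integral_nonneg) auto
  moreover have "x \<le> 1"
    unfolding x using X by (intro measure_pmf.integral_le_const
      measure_pmf.integrable_const_bound[where B=1]) auto
  \<comment> \<open>At the endpoints the transform vanishes and \<open>s\<close> is nonnegative;
    otherwise aborting always already suffices.\<close>
  ultimately consider "x = 0" | "x = 1" | "transform_T f x / 3 < \<bar>d - x\<bar>" using False by fastforce
  then show ?thesis using s T_0 T_1 by cases auto
qed

section \<open>Quantitative lower bound for one transform\<close>

text \<open>Each \<open>1/gap\<close> is at most the positive root of the quadratic equation satisfied when
  \<open>f X = c X (1 - X)\<close>; the two roots are averaged by concavity of the square root.\<close>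

lemma T_lower_bound:
  assumes c: "0 < c" and lb: "\<And>X. X \<in> {0..1} \<Longrightarrow> c * (X * (1 - X)) \<le> f X"
    and x: "0 < x" "x < 1"
  shows "c / sqrt (1 + c\<^sup>2 / 2) * (x * (1 - x)) \<le> transform_T f x"
proof -
  define y where "y = x * (1 - x)"
  define t where "t = 1 - 2 * x"
  have y: "0 < y" using x by (simp add: y_def)
  have yt: "4 * y = 1 - t\<^sup>2" by (simp add: y_def t_def power2_eq_square algebra_simps)
  have root: "2 * c * y * (1 / a) \<le> (1 + c * r) + sqrt (1 + c\<^sup>2 + 2 * c * r)"
    if a: "0 < a" and q: "c * (y - a * r - a\<^sup>2) \<le> a" and r: "r\<^sup>2 = t\<^sup>2" for a r
  proof -
    have "c * (y - a * r - a\<^sup>2) / a\<^sup>2 \<le> a / a\<^sup>2"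
      using q by (rule divide_right_mono) simp
    then have 1: "c * y * (1 / a)\<^sup>2 - c * r * (1 / a) - c \<le> 1 / a"
      using a by (simp add: power2_eq_square field_simps)
    \<comment> \<open>Completing the square after multiplication by \<open>4 * c * y\<close>; the
      identity \<open>yt\<close> then turns the discriminant into
      \<open>1 + c\<^sup>2 + 2 * c * r\<close>.\<close>
    have sq: "(2 * c * y * i - (1 + c * r))\<^sup>2
        = 4 * c * y * (c * y * i\<^sup>2 - c * r * i - i) + (1 + c * r)\<^sup>2" for i
      by (simp add: power2_eq_square algebra_simps)
    have "(2 * c * y * (1 / a) - (1 + c * r))\<^sup>2
        = 4 * c * y * (c * y * (1 / a)\<^sup>2 - c * r * (1 / a) - 1 / a) + (1 + c * r)\<^sup>2"
      by (rule sq)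
    also have "\<dots> \<le> 4 * c * y * c + (1 + c * r)\<^sup>2"
      using 1 c y by (intro add_mono mult_left_mono) auto
    also have "\<dots> = c\<^sup>2 * (4 * y) + (1 + c * r)\<^sup>2" by (simp add: power2_eq_square)
    also have "\<dots> = 1 + c\<^sup>2 + 2 * c * r"
      unfolding yt r[symmetric] by (simp add: power2_eq_square algebra_simps)
    finally show ?thesis using real_le_rsqrt by fastforce
  qed
  let ?a = "gap_S x" and ?b = "gap_L x"
  have pos: "0 < ?a" "0 < ?b" using x by (rule gap_S_pos, rule gap_L_pos)
  have "c * (y - ?a * t - ?a\<^sup>2) \<le> ?a"
    using lb[of "x - ?a"] gap_S[of x] x
    by (simp add: y_def t_def power2_eq_square algebra_simps)
  then have A: "2 * c * y * (1 / ?a) \<le> (1 + c * t) + sqrt (1 + c\<^sup>2 + 2 * c * t)"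
    using pos by (intro root) auto
  \<comment> \<open>The mirror image replaces \<open>t\<close> by \<open>- t\<close>, so the linear
    terms cancel when both bounds are added.\<close>
  have "c * (y - ?b * (- t) - ?b\<^sup>2) \<le> ?b"
    using lb[of "x + ?b"] gap_L[of x] x
    by (simp add: y_def t_def power2_eq_square algebra_simps)
  then have B: "2 * c * y * (1 / ?b) \<le> (1 + c * (- t)) + sqrt (1 + c\<^sup>2 + 2 * c * (- t))"
    using pos by (intro root) auto
  have sqrt_avg: "sqrt p + sqrt q \<le> 2 * sqrt ((p + q) / 2)" if "0 \<le> p" "0 \<le> q" for p q :: real
  proof -
    have "(sqrt p + sqrt q)\<^sup>2 \<le> 2 * (p + q)"
      using that zero_le_power2[of "sqrt p - sqrt q"]
      by (simp add: power2_eq_square algebra_simps)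
    then have "sqrt p + sqrt q \<le> sqrt (4 * ((p + q) / 2))"
      by (intro real_le_rsqrt) simp
    also have "\<dots> = 2 * sqrt ((p + q) / 2)" by (simp only: real_sqrt_mult real_sqrt_four)
    finally show ?thesis .
  qed
  have t1: "\<bar>t\<bar> \<le> 1" using x by (auto simp: t_def)
  \<comment> \<open>Both radicands are at least \<open>(1 - c)\<^sup>2\<close>.\<close>
  have "\<bar>2 * c * t\<bar> \<le> 2 * c" using t1 c by (simp add: abs_mult)
  moreover have "0 \<le> 1 + c\<^sup>2 - 2 * c" using zero_le_power2[of "1 - c"]
    by (simp add: power2_eq_square algebra_simps)
  ultimately have "0 \<le> 1 + c\<^sup>2 + 2 * c * t" "0 \<le> 1 + c\<^sup>2 + 2 * c * (- t)"
    by (auto simp: abs_le_iff)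
  from sqrt_avg[OF this]
  have "sqrt (1 + c\<^sup>2 + 2 * c * t) + sqrt (1 + c\<^sup>2 + 2 * c * (- t)) \<le> 2 * sqrt (1 + c\<^sup>2)"
    by (simp add: add_divide_distrib)
  moreover have "1 + sqrt (1 + c\<^sup>2) \<le> 2 * sqrt (1 + c\<^sup>2 / 2)"
    using sqrt_avg[of 1 "1 + c\<^sup>2"] by (simp add: add_divide_distrib)
  ultimately have "2 * c * y * (1 / ?a) + 2 * c * y * (1 / ?b) \<le> 4 * sqrt (1 + c\<^sup>2 / 2)"
    using A B by simp
  then have "c * y * (?a + ?b) \<le> sqrt (1 + c\<^sup>2 / 2) * (2 * ?a * ?b)"
    using pos by (simp add: field_simps)
  moreover have "0 < sqrt (1 + c\<^sup>2 / 2)" by (simp add: add_pos_nonneg)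
  ultimately show ?thesis
    using pos by (simp add: T_eq harmonic_mean_def y_def field_simps)
qed

end

section \<open>Iterates starting from the parabola\<close>

lemma C'_1: "C' (Suc 0) = (\<lambda>X. X * (1 - X))"
  by (simp add: C'_def)

lemma C'_Suc: "n \<ge> 1 \<Longrightarrow> C' (Suc n) = transform_T (C' n)"
  by (cases n) (simp_all add: C'_def)

lemma hump_parabola: "hump (\<lambda>X. X * (1 - X))"
proof
  show "concave_on {0..1} (\<lambda>X::real. X * (1 - X))"
    unfolding concave_on_iff
  proof (intro conjI ballI allI impI)
    fix x y u v :: real assume *: "0 \<le> u" "0 \<le> v" "u + v = 1"
    then have v: "v = 1 - u" by simp
    have "(u * x + v * y) * (1 - (u * x + v * y)) - (u * (x * (1 - x)) + v * (y * (1 - y)))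
        = u * v * (x - y)\<^sup>2"
      unfolding v by (simp add: power2_eq_square algebra_simps)
    also have "\<dots> \<ge> 0" using * by simp
    finally show "u * (x * (1 - x)) + v * (y * (1 - y))
        \<le> (u *\<^sub>R x + v *\<^sub>R y) * (1 - (u *\<^sub>R x + v *\<^sub>R y))" by simp
  qed simp
qed (auto simp: mult_less_cancel_left1 mult_less_cancel_right1)

lemma hump_C': "n \<ge> 1 \<Longrightarrow> hump (C' n)"
  by (induction n rule: dec_induct)
    (simp_all add: C'_1 C'_Suc hump_parabola hump.hump_transform_T)

text \<open>Passing from \<open>c\<close> to \<open>c / sqrt (1 + c\<^sup>2 / 2)\<close> adds
  \<open>1/2\<close> to \<open>1 / c\<^sup>2\<close>; starting at \<open>c = 1\<close>, this yields
  \<open>c\<^sup>2 = 2 / (n + 1)\<close>.\<close>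

lemma C'_lower_bound:
  assumes "n \<ge> 1" "x \<in> {0..1}"
  shows "sqrt (2 / (real n + 1)) * (x * (1 - x)) \<le> C' n x"
  using assms
proof (induction n arbitrary: x rule: dec_induct)
  case base
  then show ?case by (simp add: C'_1)
next
  case (step n)
  interpret hump "C' n" using step by (intro hump_C')
  let ?c = "sqrt (2 / (real n + 1))"
  have c2: "1 + ?c\<^sup>2 / 2 = (real n + 2) / (real n + 1)" by (simp add: field_simps)
  have "?c / sqrt (1 + ?c\<^sup>2 / 2) = sqrt (2 / (real n + 1) / ((real n + 2) / (real n + 1)))"
    unfolding c2 by (simp only: real_sqrt_divide)
  also have "2 / (real n + 1) / ((real n + 2) / (real n + 1)) = 2 / (real n + 2)"
    by (simp add: divide_simps del: of_nat_Suc)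
  also have "real n + 2 = real (Suc n) + 1" by simp
  finally have eq: "?c / sqrt (1 + ?c\<^sup>2 / 2) = sqrt (2 / (real (Suc n) + 1))" .
  show ?case
  proof (cases "x = 0 \<or> x = 1")
    case True
    then show ?thesis using step T_0 T_1 by (auto simp: C'_Suc)
  next
    case False
    then have "?c / sqrt (1 + ?c\<^sup>2 / 2) * (x * (1 - x)) \<le> transform_T (C' n) x"
      using step by (intro T_lower_bound) auto
    then show ?thesis unfolding eq using step by (simp add: C'_Suc)
  qed
qed

section \<open>Attacks on a protocol\<close>

abbreviation never :: "'m list \<Rightarrow> bool" where "never \<equiv> (\<lambda>_. False)"

lemma take_Suc_length_eq_snocD:
  assumes "take (Suc (length h)) l = h @ [m]"
  shows "take (length h) l = h" and "l ! length h = m"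
proof -
  show "take (length h) l = h"
    using arg_cong[OF assms, of "take (length h)"] by (simp add: min_def)
  show "l ! length h = m"
    using arg_cong[OF assms, of "\<lambda>l. l ! length h"] by simp
qed

text \<open>Rules are consulted with the pending message appended, so Alice's see odd lengths and
  Bob's even ones. A single rule used by both parties can therefore encode one corrupted
  party.\<close>

lemma run_cong:
  assumes "\<And>a l. odd (length l) \<Longrightarrow> length h < length l \<Longrightarrow> take (length h) l = h \<Longrightarrow> qA a l = qA' a l"
    and "\<And>b l. even (length l) \<Longrightarrow> length h < length l \<Longrightarrow> take (length h) l = h \<Longrightarrow> qB b l = qB' b l"
  shows "run P qA qB k a b h = run P qA' qB' k a b h"
  using assms
proof (induction k arbitrary: a b h)
  case (Suc k)
  have "run P qA qB k a b (h @ [m]) = run P qA' qB' k a b (h @ [m])" for a b m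
    by (intro Suc.IH Suc.prems) (auto dest: take_Suc_length_eq_snocD(1))
  moreover have "even (length h) \<Longrightarrow> qA a (h @ [m]) = qA' a (h @ [m])" for a m
    using Suc.prems(1) by simp
  moreover have "odd (length h) \<Longrightarrow> qB b (h @ [m]) = qB' b (h @ [m])" for b m
    using Suc.prems(2) by simp
  ultimately show ?case by (simp cong: if_cong)
qed simp

section \<open>The protocol as a tree of transcripts\<close>

text \<open>Below, \<open>\<mu>\<close> is the conditional law of the pair of private states given the transcript.\<close>

definition next_joint ::
  "('a, 'b, 'm) protocol \<Rightarrow> ('a \<times> 'b) pmf \<Rightarrow> 'm list \<Rightarrow> ('m \<times> 'a \<times> 'b) pmf" where
  "next_joint P \<mu> h = bind_pmf \<mu> (\<lambda>(a, b).
     if even (length h) then map_pmf (\<lambda>(m, a'). (m, a', b)) (step_alice P a h)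
     else map_pmf (\<lambda>(m, b'). (m, a, b')) (step_bob P b h))"

definition next_message ::
  "('a, 'b, 'm) protocol \<Rightarrow> ('a \<times> 'b) pmf \<Rightarrow> 'm list \<Rightarrow> 'm pmf" where
  "next_message P \<mu> h = map_pmf fst (next_joint P \<mu> h)"

definition posterior ::
  "('a, 'b, 'm) protocol \<Rightarrow> ('a \<times> 'b) pmf \<Rightarrow> 'm list \<Rightarrow> 'm \<Rightarrow> ('a \<times> 'b) pmf" where
  "posterior P \<mu> h m = map_pmf snd (cond_pmf (next_joint P \<mu> h) {z. m = fst z})"

lemma bind_cond_pmf_fst:
  "bind_pmf (map_pmf fst J) (\<lambda>m. cond_pmf J {z. m = fst z}) = J"
proof (rule bind_cond_pmf_cancel)
  fix m z assume "m \<in> set_pmf (map_pmf fst J)" "z \<in> set_pmf J" "m = fst z"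
  then show "measure J {z. m = fst z} = measure (map_pmf fst J) {m. m = fst z}"
    by (simp add: vimage_def eq_commute)
qed auto

text \<open>Both parties may use the same rule \<open>q\<close>: the parity of the length of a transcript determines
  who is about to send its last message.\<close>

definition law ::
  "('a, 'b, 'm) protocol \<Rightarrow> ('m list \<Rightarrow> bool) \<Rightarrow> ('a \<times> 'b) pmf \<Rightarrow> nat \<Rightarrow> 'm list \<Rightarrow> bool pmf" where
  "law P q \<mu> k h = bind_pmf \<mu> (\<lambda>(a, b). run P (\<lambda>_. q) (\<lambda>_. q) k a b h)"

text \<open>The rule sees only messages, so after each message the private states may be resampled
  from their conditional law.\<close>

lemma law_Suc:
  "law P q \<mu> (Suc k) h = bind_pmf (next_message P \<mu> h) (\<lambda>m.
     if q (h @ [m]) then defense P h else law P q (posterior P \<mu> h m) k (h @ [m]))"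
proof -
  let ?J = "next_joint P \<mu> h"
  define G where "G = (\<lambda>(m, a, b). if q (h @ [m]) then defense P h
    else run P (\<lambda>_. q) (\<lambda>_. q) k a b (h @ [m]))"
  have "law P q \<mu> (Suc k) h = bind_pmf ?J G"
    by (auto simp: law_def next_joint_def G_def bind_assoc_pmf bind_map_pmf case_prod_unfold
        intro!: bind_pmf_cong)
  also have "\<dots> = bind_pmf (map_pmf fst ?J) (\<lambda>m. bind_pmf (cond_pmf ?J {z. m = fst z}) G)"
    by (subst bind_cond_pmf_fst[of ?J, symmetric]) (rule bind_assoc_pmf)
  also have "\<dots> = bind_pmf (map_pmf fst ?J) (\<lambda>m.
     if q (h @ [m]) then defense P h else law P q (posterior P \<mu> h m) k (h @ [m]))"
  proof (rule bind_pmf_cong[OF refl])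
    fix m assume "m \<in> set_pmf (map_pmf fst ?J)"
    then have ne: "set_pmf ?J \<inter> {z. m = fst z} \<noteq> {}" by auto
    have "bind_pmf (cond_pmf ?J {z. m = fst z}) G = bind_pmf (cond_pmf ?J {z. m = fst z})
       (\<lambda>z. if q (h @ [m]) then defense P h
         else run P (\<lambda>_. q) (\<lambda>_. q) k (fst (snd z)) (snd (snd z)) (h @ [m]))"
      using set_cond_pmf[OF ne] by (intro bind_pmf_cong) (auto simp: G_def)
    also have "\<dots> = (if q (h @ [m]) then defense P h else law P q (posterior P \<mu> h m) k (h @ [m]))"
      by (simp add: law_def posterior_def bind_map_pmf case_prod_unfold)
    finally show "bind_pmf (cond_pmf ?J {z. m = fst z}) G =
      (if q (h @ [m]) then defense P h else law P q (posterior P \<mu> h m) k (h @ [m]))" .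
  qed
  finally show ?thesis by (simp add: next_message_def)
qed

lemma law_cong:
  assumes "\<And>l. length h < length l \<Longrightarrow> take (length h) l = h \<Longrightarrow> q l = q' l"
  shows "law P q \<mu> k h = law P q' \<mu> k h"
proof -
  have "run P (\<lambda>_. q) (\<lambda>_. q) k a b h = run P (\<lambda>_. q') (\<lambda>_. q') k a b h" for a b
    using assms by (intro run_cong)
  then show ?thesis by (simp add: law_def)
qed

definition win ::
  "('a, 'b, 'm) protocol \<Rightarrow> ('m list \<Rightarrow> bool) \<Rightarrow> ('a \<times> 'b) pmf \<Rightarrow> nat \<Rightarrow> 'm list \<Rightarrow> real" where
  "win P q \<mu> k h = pmf (law P q \<mu> k h) True"

lemma win_range: "win P q \<mu> k h \<in> {0..1}"
  by (simp add: win_def pmf_le_1)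

lemma win_0: "win P q \<mu> 0 h = of_bool (outcome P h)"
  by (cases "outcome P h") (simp_all add: win_def law_def case_prod_unfold bind_pmf_const)

text \<open>For \<open>never\<close> this is the martingale property of the honest values.\<close>

lemma win_Suc:
  "win P q \<mu> (Suc k) h = measure_pmf.expectation (next_message P \<mu> h) (\<lambda>m.
     if q (h @ [m]) then pmf (defense P h) True else win P q (posterior P \<mu> h m) k (h @ [m]))"
  unfolding win_def law_Suc pmf_bind by (intro Bochner_Integration.integral_cong) simp_all

lemma integrable_bounded_pmf:
  fixes f :: "'c \<Rightarrow> real"
  assumes "\<And>x. \<bar>f x\<bar> \<le> B"
  shows "integrable (measure_pmf M) f"
  using assms by (intro measure_pmf.integrable_const_bound[where B=B]) auto

section \<open>Gains of a corrupted party\<close>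

text \<open>\<open>gain P p s k \<mu> h\<close> is the best change in direction \<open>s = \<plusminus>1\<close> that the corrupted party (Alice
  for \<open>p\<close>, Bob for \<open>\<not> p\<close>) achieves with a rule depending on the transcript only.\<close>

primrec gain ::
  "('a, 'b, 'm) protocol \<Rightarrow> bool \<Rightarrow> real \<Rightarrow> nat \<Rightarrow> ('a \<times> 'b) pmf \<Rightarrow> 'm list \<Rightarrow> real" where
  "gain P p s 0 \<mu> h = 0"
| "gain P p s (Suc k) \<mu> h = measure_pmf.expectation (next_message P \<mu> h) (\<lambda>m.
     if even (length h) = p
     then max (s * (pmf (defense P h) True - win P never (posterior P \<mu> h m) k (h @ [m])))
              (gain P p s k (posterior P \<mu> h m) (h @ [m]))
     else gain P p s k (posterior P \<mu> h m) (h @ [m]))"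

lemma abs_signed_diff_le:
  fixes s :: real
  assumes "\<bar>s\<bar> = 1"
  shows "\<bar>s * (pmf D True - win P q \<mu> k h)\<bar> \<le> 1"
proof -
  have "\<bar>pmf D True - win P q \<mu> k h\<bar> \<le> 1"
    using win_range[of P q \<mu> k h] pmf_nonneg[of D True] pmf_le_1[of D True]
    unfolding atLeastAtMost_iff by linarith
  then show ?thesis using assms by (simp add: abs_mult)
qed

lemma gain_range:
  assumes "\<bar>s\<bar> = 1"
  shows "gain P p s k \<mu> h \<in> {0..1}"
proof (induction k arbitrary: \<mu> h)
  case (Suc k)
  let ?F = "\<lambda>m. if even (length h) = p
     then max (s * (pmf (defense P h) True - win P never (posterior P \<mu> h m) k (h @ [m])))
              (gain P p s k (posterior P \<mu> h m) (h @ [m]))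
     else gain P p s k (posterior P \<mu> h m) (h @ [m])"
  have F: "0 \<le> ?F m" "?F m \<le> 1" for m
    using Suc[of "posterior P \<mu> h m" "h @ [m]"]
      abs_signed_diff_le[OF assms, of "defense P h" P never "posterior P \<mu> h m" k "h @ [m]"]
    by auto
  have "integrable (next_message P \<mu> h) ?F"
    using F by (intro integrable_bounded_pmf[where B=1]) (simp only: abs_of_nonneg)
  then have "measure_pmf.expectation (next_message P \<mu> h) ?F \<le> 1"
    using F by (intro measure_pmf.integral_le_const) auto
  moreover have "0 \<le> measure_pmf.expectation (next_message P \<mu> h) ?F"
    using F by (intro Bochner_Integration.integral_nonneg) auto
  ultimately show ?case by simp
qed simp

text \<open>Optimal rules for the subtrees, one for each next message, are glued together with the
  better choice at the current node. Honest values are the baseline throughout, and they average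
  correctly.\<close>

lemma gain_attained:
  fixes s :: real
  assumes s: "\<bar>s\<bar> = 1"
  shows "\<exists>q. (\<forall>l. q l \<longrightarrow> odd (length l) = p) \<and>
    s * (win P q \<mu> k h - win P never \<mu> k h) = gain P p s k \<mu> h"
proof (induction k arbitrary: \<mu> h)
  case 0
  then show ?case by (intro exI[of _ never]) simp
next
  case (Suc k)
  let ?\<mu> = "posterior P \<mu> h" and ?d = "pmf (defense P h) True" and ?M = "next_message P \<mu> h"
  let ?x = "\<lambda>m. win P never (?\<mu> m) k (h @ [m])" and ?g = "\<lambda>m. gain P p s k (?\<mu> m) (h @ [m])"
  have "\<forall>m. \<exists>r. (\<forall>l. r l \<longrightarrow> odd (length l) = p) \<and>
      s * (win P r (?\<mu> m) k (h @ [m]) - ?x m) = ?g m"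
    using Suc.IH by blast
  from choice[OF this] obtain r where r: "\<And>m l. r m l \<Longrightarrow> odd (length l) = p"
    and r_eq: "\<And>m. s * (win P (r m) (?\<mu> m) k (h @ [m]) - ?x m) = ?g m"
    by blast
  \<comment> \<open>The entry \<open>l ! length h\<close> selects the subtree. The parity test
    leaves the decision on the current message to the corrupted party; ties go to
    continuing.\<close>
  define q where "q l = (let m = l ! length h in
    if length l = Suc (length h) then even (length h) = p \<and> ?g m < s * (?d - ?x m) else r m l)" for l
  have "win P q (?\<mu> m) k (h @ [m]) = win P (r m) (?\<mu> m) k (h @ [m])" for m
  proof -
    have "law P q (?\<mu> m) k (h @ [m]) = law P (r m) (?\<mu> m) k (h @ [m])"
      using take_Suc_length_eq_snocD(2)[of h _ m] by (intro law_cong) (auto simp: q_def Let_def)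
    then show ?thesis by (simp add: win_def)
  qed
  then have wq: "win P q \<mu> (Suc k) h = measure_pmf.expectation ?M (\<lambda>m.
      if q (h @ [m]) then ?d else win P (r m) (?\<mu> m) k (h @ [m]))"
    by (simp add: win_Suc cong: if_cong)
  have "integrable ?M (\<lambda>m. if q (h @ [m]) then ?d else win P (r m) (?\<mu> m) k (h @ [m]))"
    using win_range[of P] by (intro integrable_bounded_pmf[where B=1]) (auto simp: pmf_le_1)
  moreover have "integrable ?M ?x"
    using win_range[of P] by (intro integrable_bounded_pmf[where B=1]) auto
  ultimately have "s * (win P q \<mu> (Suc k) h - win P never \<mu> (Suc k) h)
     = measure_pmf.expectation ?M (\<lambda>m.
         s * ((if q (h @ [m]) then ?d else win P (r m) (?\<mu> m) k (h @ [m])) - ?x m))"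
    unfolding wq win_Suc[of P never] by simp
  also have "\<dots> = gain P p s (Suc k) \<mu> h"
    unfolding gain.simps
    by (intro arg_cong[where f="measure_pmf.expectation ?M"] ext)
      (auto simp: q_def r_eq max_def)
  finally have "s * (win P q \<mu> (Suc k) h - win P never \<mu> (Suc k) h) = gain P p s (Suc k) \<mu> h" .
  moreover have "\<forall>l. q l \<longrightarrow> odd (length l) = p"
    using r by (auto simp: q_def Let_def split: if_splits)
  ultimately show ?case by blast
qed

section \<open>The score and its two lower bounds\<close>

definition score ::
  "('a, 'b, 'm) protocol \<Rightarrow> nat \<Rightarrow> ('a \<times> 'b) pmf \<Rightarrow> 'm list \<Rightarrow> real" where
  "score P k \<mu> h =
     gain P True 1 k \<mu> h + gain P True (-1) k \<mu> h + gain P False 1 k \<mu> h + gain P False (-1) k \<mu> h"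

lemma score_range: "score P k \<mu> h \<in> {0..4}"
  using gain_range[of 1 P True k \<mu> h] gain_range[of "-1" P True k \<mu> h]
    gain_range[of 1 P False k \<mu> h] gain_range[of "-1" P False k \<mu> h]
  by (auto simp: score_def)

lemma gain_Suc_mover:
  assumes "even (length h) = p"
  shows "gain P p s (Suc k) \<mu> h = measure_pmf.expectation (next_message P \<mu> h) (\<lambda>m.
     max (s * (pmf (defense P h) True - win P never (posterior P \<mu> h m) k (h @ [m])))
         (gain P p s k (posterior P \<mu> h m) (h @ [m])))"
  using assms by simp

lemma gain_Suc_other:
  assumes "even (length h) \<noteq> p"
  shows "gain P p s (Suc k) \<mu> h = measure_pmf.expectation (next_message P \<mu> h) (\<lambda>m.
     gain P p s k (posterior P \<mu> h m) (h @ [m]))"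
  using assms by (simp cong: if_cong)

lemma score_swap:
  "score P k \<mu> h = gain P p 1 k \<mu> h + gain P p (-1) k \<mu> h
     + gain P (\<not> p) 1 k \<mu> h + gain P (\<not> p) (-1) k \<mu> h"
  by (cases p) (simp_all add: score_def)

text \<open>Keeping only the first argument of the maximum is aborting on every message; the honest
  child values then average to that of the node.\<close>

lemma gain_ge_abort:
  fixes s :: real
  assumes s: "\<bar>s\<bar> = 1" and "even (length h) = p"
  shows "s * (pmf (defense P h) True - win P never \<mu> (Suc k) h) \<le> gain P p s (Suc k) \<mu> h"
proof -
  let ?\<mu> = "posterior P \<mu> h" and ?d = "pmf (defense P h) True" and ?M = "next_message P \<mu> h"
  let ?x = "\<lambda>m. win P never (?\<mu> m) k (h @ [m])" and ?g = "\<lambda>m. gain P p s k (?\<mu> m) (h @ [m])"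
  have int: "integrable ?M ?x"
    using win_range[of P] by (intro integrable_bounded_pmf[where B=1]) auto
  then have "s * (?d - win P never \<mu> (Suc k) h) = measure_pmf.expectation ?M (\<lambda>m. s * (?d - ?x m))"
    by (simp add: win_Suc)
  also have "\<dots> \<le> measure_pmf.expectation ?M (\<lambda>m. max (s * (?d - ?x m)) (?g m))"
  proof (rule integral_mono)
    show "integrable ?M (\<lambda>m. s * (?d - ?x m))" using int by simp
    have "\<bar>max (s * (?d - ?x m)) (?g m)\<bar> \<le> 1" for m
      using gain_range[OF s, of P p k "?\<mu> m" "h @ [m]"]
        abs_signed_diff_le[OF s, of "defense P h" P never "?\<mu> m" k "h @ [m]"] by auto
    then show "integrable ?M (\<lambda>m. max (s * (?d - ?x m)) (?g m))"
      by (rule integrable_bounded_pmf)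
  qed auto
  also have "\<dots> = gain P p s (Suc k) \<mu> h" using assms by simp
  finally show ?thesis .
qed

lemma score_ge_abort:
  "\<bar>pmf (defense P h) True - win P never \<mu> (Suc k) h\<bar> \<le> score P (Suc k) \<mu> h"
proof -
  define p where "p = even (length h)"
  have "0 \<le> gain P q s (Suc k) \<mu> h" if "\<bar>s\<bar> = 1" for q s
    using gain_range[OF that, of P q "Suc k" \<mu> h] by auto
  from this[of 1 p] this[of 1 "\<not> p"] this[of "-1" p] this[of "-1" "\<not> p"] show ?thesis
    using gain_ge_abort[of 1 h p P \<mu> k] gain_ge_abort[of "-1" h p P \<mu> k]
    unfolding score_swap[of P _ _ _ p] by (auto simp: p_def simp del: gain.simps)
qed

text \<open>Only the attack in the direction of \<open>u\<close> needs to abort. The other three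
  gains are kept, and being nonnegative they do no harm when \<open>\<bar>u\<bar>\<close>
  dominates.\<close>

lemma max_abs_le_signed_max:
  fixes u :: real
  assumes "0 \<le> a" "0 \<le> b" "0 \<le> c" "0 \<le> d"
  shows "max \<bar>u\<bar> (a + b + c + d) \<le> max (1 * u) a + max (- 1 * u) b + c + d"
  using assms by (cases "0 \<le> u") auto

lemma score_ge_continue:
  "measure_pmf.expectation (next_message P \<mu> h) (\<lambda>m.
     max \<bar>pmf (defense P h) True - win P never (posterior P \<mu> h m) k (h @ [m])\<bar>
         (score P k (posterior P \<mu> h m) (h @ [m]))) \<le> score P (Suc k) \<mu> h"
proof -
  define p where "p = even (length h)"
  let ?\<mu> = "posterior P \<mu> h" and ?d = "pmf (defense P h) True" and ?M = "next_message P \<mu> h"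
  let ?x = "\<lambda>m. win P never (?\<mu> m) k (h @ [m])" and ?g = "\<lambda>q s m. gain P q s k (?\<mu> m) (h @ [m])"
  have g: "0 \<le> ?g q s m" "?g q s m \<le> 1" if "\<bar>s\<bar> = 1" for q s m
    using gain_range[OF that, of P q k "?\<mu> m" "h @ [m]"] by auto
  have dx: "\<bar>?d - ?x m\<bar> \<le> 1" for m
    using abs_signed_diff_le[of 1 "defense P h" P never "?\<mu> m" k "h @ [m]"] by simp
  have int1: "integrable ?M (\<lambda>m. max (s * (?d - ?x m)) (?g q s m))" if s: "\<bar>s\<bar> = 1" for q s
  proof (rule integrable_bounded_pmf)
    show "\<bar>max (s * (?d - ?x m)) (?g q s m)\<bar> \<le> 1" for m
      using g[OF s, of q m] abs_signed_diff_le[OF s, of "defense P h" P never "?\<mu> m" k "h @ [m]"]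
      by auto
  qed
  have int2: "integrable ?M (?g q s)" if s: "\<bar>s\<bar> = 1" for q s
    using g[OF s] by (intro integrable_bounded_pmf[where B=1]) (simp only: abs_of_nonneg)
  let ?R = "\<lambda>m. max (1 * (?d - ?x m)) (?g p 1 m) + max (- 1 * (?d - ?x m)) (?g p (-1) m)
     + ?g (\<not> p) 1 m + ?g (\<not> p) (-1) m"
  have int3: "integrable ?M ?R"
    by (intro Bochner_Integration.integrable_add int1 int2) simp_all
  have "measure_pmf.expectation ?M (\<lambda>m. max \<bar>?d - ?x m\<bar> (score P k (?\<mu> m) (h @ [m])))
    \<le> measure_pmf.expectation ?M ?R"
  proof (rule integral_mono)
    have "\<bar>max (\<bar>?d - ?x m\<bar>) (score P k (?\<mu> m) (h @ [m]))\<bar> \<le> 4" for m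
      using dx[of m] score_range[of P k "?\<mu> m" "h @ [m]"] by auto
    then show "integrable ?M (\<lambda>m. max \<bar>?d - ?x m\<bar> (score P k (?\<mu> m) (h @ [m])))"
      by (rule integrable_bounded_pmf)
    show "integrable ?M ?R" by (rule int3)
    show "max \<bar>?d - ?x m\<bar> (score P k (?\<mu> m) (h @ [m])) \<le> ?R m" for m
      unfolding score_swap[of P _ _ _ p] by (intro max_abs_le_signed_max g) simp_all
  qed
  also have "\<dots> = score P (Suc k) \<mu> h"
    using int1[of 1 p] int1[of "-1" p] int2[of 1 "\<not> p"] int2[of "-1" "\<not> p"]
    unfolding score_swap[of P _ _ _ p]
    by (simp add: p_def gain_Suc_mover gain_Suc_other del: gain.simps)
  finally show ?thesis .
qed

section \<open>Induction on the rounds and the final attack\<close>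

lemma score_ge_C':
  assumes "k \<ge> 1"
  shows "C' k (win P never \<mu> k h) / 3 \<le> score P k \<mu> h"
  using assms
proof (induction k arbitrary: \<mu> h rule: dec_induct)
  case base
  let ?\<mu> = "posterior P \<mu> h" and ?d = "pmf (defense P h) True" and ?M = "next_message P \<mu> h"
  let ?x = "\<lambda>m. win P never (?\<mu> m) 0 (h @ [m])"
  define x where "x = win P never \<mu> (Suc 0) h"
  have x: "0 \<le> x" "x \<le> 1" using win_range[of P never \<mu> "Suc 0" h] by (auto simp: x_def)
  have d: "0 \<le> ?d" "?d \<le> 1" by (simp_all add: pmf_le_1)
  have int: "integrable ?M ?x"
    using win_range[of P] by (intro integrable_bounded_pmf[where B=1]) auto
  \<comment> \<open>One round gives the full parabola; the factor \<open>1/3\<close> comes from the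
    induction step.\<close>
  have "x * (1 - x) \<le> ?d + (1 - 2 * ?d) * x"
  proof -
    have "?d + (1 - 2 * ?d) * x - x * (1 - x) = (1 - ?d) * x\<^sup>2 + ?d * (1 - x)\<^sup>2"
      by (simp add: power2_eq_square algebra_simps)
    also have "\<dots> \<ge> 0" using d by simp
    finally show ?thesis by simp
  qed
  also have "\<dots> = measure_pmf.expectation ?M (\<lambda>m. ?d + (1 - 2 * ?d) * ?x m)"
    using int by (simp add: x_def win_Suc)
  \<comment> \<open>Leaf values are \<open>0\<close> or \<open>1\<close> and leaf scores are
    \<open>0\<close>, so the distance from the defense is affine in the leaf value.\<close>
  also have "\<dots> = measure_pmf.expectation ?M (\<lambda>m. max \<bar>?d - ?x m\<bar> (score P 0 (?\<mu> m) (h @ [m])))"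
    using d by (intro arg_cong[where f="measure_pmf.expectation ?M"] ext)
      (auto simp: win_0 score_def of_bool_def)
  also have "\<dots> \<le> score P (Suc 0) \<mu> h" by (rule score_ge_continue)
  finally have "x * (1 - x) \<le> score P (Suc 0) \<mu> h" .
  moreover have "0 \<le> x * (1 - x)" using x by simp
  ultimately show ?case by (simp add: C'_1 x_def)
next
  case (step k)
  interpret hump "C' k" using step by (intro hump_C')
  have "transform_T (C' k) (win P never \<mu> (Suc k) h) / 3 \<le> score P (Suc k) \<mu> h"
  proof (rule score_step)
    show "win P never (posterior P \<mu> h m) k (h @ [m]) \<in> {0..1}" for m by (rule win_range)
    show "win P never \<mu> (Suc k) h = measure_pmf.expectation (next_message P \<mu> h)
        (\<lambda>m. win P never (posterior P \<mu> h m) k (h @ [m]))"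
      by (simp add: win_Suc)
    show "C' k (win P never (posterior P \<mu> h m) k (h @ [m])) / 3
        \<le> score P k (posterior P \<mu> h m) (h @ [m])" for m
      by (rule step.IH)
    show "score P k (posterior P \<mu> h m) (h @ [m]) \<le> 4" for m
      using score_range by auto
    show "\<bar>pmf (defense P h) True - win P never \<mu> (Suc k) h\<bar> \<le> score P (Suc k) \<mu> h"
      by (rule score_ge_abort)
    show "measure_pmf.expectation (next_message P \<mu> h)
      (\<lambda>m. max \<bar>pmf (defense P h) True - win P never (posterior P \<mu> h m) k (h @ [m])\<bar>
         (score P k (posterior P \<mu> h m) (h @ [m]))) \<le> score P (Suc k) \<mu> h"
      by (rule score_ge_continue)
  qed
  then show ?case using step by (simp add: C'_Suc)
qed

theorem theorem2:
  fixes P :: "('a, 'b, 'm) protocol" and n :: nat and X0 :: real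
  assumes "n \<ge> 1" and "bias P n = X0"
  shows "(\<exists>adv :: ('a, 'b, 'm) fail_stop.
            \<bar>pmf (attacked_run P n adv) True - X0\<bar> \<ge> 1/12 * C' n X0) \<and>
         1/12 * C' n X0 \<ge> 1/12 * sqrt (2 / (real n + 1)) * X0 * (1 - X0)"
proof
  let ?\<mu> = "return_pmf (init_alice P, init_bob P)"
  have X0: "win P never ?\<mu> n [] = X0"
    using assms(2) by (simp add: win_def law_def bind_return_pmf bias_def honest_run_def)
  then have "C' n X0 / 3 \<le> score P n ?\<mu> []"
    using score_ge_C'[OF assms(1), of P ?\<mu> "[]"] by simp
  \<comment> \<open>The score is a sum of four gains, so one of them is at least a quarter of
    \<open>C' n X0 / 3\<close>.\<close>
  then obtain p and s :: real where s: "\<bar>s\<bar> = 1" and gain: "C' n X0 / 12 \<le> gain P p s n ?\<mu> []"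
  proof -
    have "\<exists>p s. \<bar>s\<bar> = 1 \<and> C' n X0 / 12 \<le> gain P p s n ?\<mu> []"
    proof (rule ccontr)
      assume "\<not> ?thesis"
      then have less: "gain P p s n ?\<mu> [] < C' n X0 / 12" if "\<bar>s\<bar> = 1" for p s
        using that not_le by blast
      show False
        using \<open>C' n X0 / 3 \<le> score P n ?\<mu> []\<close> less[of 1 True] less[of "-1" True]
          less[of 1 False] less[of "-1" False] unfolding score_def by simp
    qed
    then show thesis using that by blast
  qed
  from gain_attained[OF s, of p P ?\<mu> n "[]"] obtain q
    where q: "\<And>l. q l \<Longrightarrow> odd (length l) = p"
      and eq: "s * (win P q ?\<mu> n [] - X0) = gain P p s n ?\<mu> []"
    unfolding X0 by auto
  have "gain P p s n ?\<mu> [] \<le> \<bar>s * (win P q ?\<mu> n [] - X0)\<bar>" unfolding eq by simp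
  then have far: "C' n X0 / 12 \<le> \<bar>win P q ?\<mu> n [] - X0\<bar>"
    using gain s by (simp add: abs_mult)
  define adv where "adv = (if p then Corrupt_Alice (\<lambda>_. q) else Corrupt_Bob (\<lambda>_. q)
    :: ('a, 'b, 'm) fail_stop)"
  \<comment> \<open>By its parity, \<open>q\<close> never fires for the honest party, so giving it
    to both parties changes nothing.\<close>
  have "attacked_run P n adv = run P (\<lambda>_. q) (\<lambda>_. q) n (init_alice P) (init_bob P) []"
    using q by (cases p) (auto simp: adv_def intro!: run_cong)
  then have "pmf (attacked_run P n adv) True = win P q ?\<mu> n []"
    by (simp add: win_def law_def bind_return_pmf)
  then show "\<exists>adv :: ('a, 'b, 'm) fail_stop.
      \<bar>pmf (attacked_run P n adv) True - X0\<bar> \<ge> 1/12 * C' n X0"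
    using far by (intro exI[of _ adv]) simp
  have "X0 \<in> {0..1}" using win_range[of P never ?\<mu> n "[]"] by (simp add: X0)
  then have "1/12 * (sqrt (2 / (real n + 1)) * (X0 * (1 - X0))) \<le> 1/12 * C' n X0"
    using C'_lower_bound[OF assms(1)] by (intro mult_left_mono) auto
  then show "1/12 * C' n X0 \<ge> 1/12 * sqrt (2 / (real n + 1)) * X0 * (1 - X0)"
    by (simp only: mult.assoc)
qed

end
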